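(* Let $\delta\in(0,1)$ and let $\{\beta_t\}_{t\ge1}$ be a positive nondecreasing sequence such that, with probability at least $1-\delta$, the following event $\mathcal E$ holds: for all agents $n\in\{1,\dots,N\}$, rounds $t\ge1$ and points $\mathbf{x}\in\mathcal X$, $|f_n(\mathbf{x})-\mu_{n,t-1}(\mathbf{x})|\le\sqrt{\beta_t}\,\sigma_{n,t-1}(\mathbf{x})$. Fix an agent $n$ and a round $t$, suppose $\lambda_t\ge0$, and let $\mathbf{x}_{n,t}$ be selected by GUIDE-UCB, i.e. $$\mathbf{x}_{n,t}\in\arg\max_{\mathbf{x}\in\mathcal X}\ \mu_{n,t-1}(\mathbf{x})+\sqrt{\beta_t}\,\bigl(1+\lambda_tG_{n,t}(\mathbf{x})\bigr)\,\sigma_{n,t-1}(\mathbf{x}).$$ Then on $\mathcal E$ (hence with probability at least $1-\delta$) the following holds. If $\mathbf{x}_{n,t}$ is suboptimal, i.e. $\Delta_n(\mathbf{x}_{n,t}):=f_n(\mathbf{x}_n^* )-f_n(\mathbf{x}_{n,t})>0$, then $$\sigma_{n,t-1}(\mathbf{x}_{n,t})\ \ge\ \frac{\Delta_n(\mathbf{x}_{n,t})+\lambda_t\sqrt{\beta_t}\,G_{n,t}(\mathbf{x}_n^* )\,\sigma_{n,t-1}(\mathbf{x}_n^* )}{\sqrt{\beta_t}\,\bigl(2+\lambda_tG_{n,t}(\mathbf{x}_{n,t})\bigr)}.$$ If, in addition, $G_{n,t}(\mathbf{x}_n^* )\ge c$ and $G_{n,t}(\mathbf{x}_{n,t})\le\varepsilon_G$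 for some $c>0$ and $\varepsilon_G\ge0$, and $\lambda_t=\lambda_{\max}/\sqrt t$ with $\lambda_{\max}\ge0$, then $$\sigma_{n,t-1}(\mathbf{x}_{n,t})\ \ge\ \frac{\Delta_n(\mathbf{x}_{n,t})+\frac{\lambda_{\max}c}{\sqrt t}\sqrt{\beta_t}\,\sigma_{n,t-1}(\mathbf{x}_n^* )}{\sqrt{\beta_t}\,\Bigl(2+\frac{\lambda_{\max}\varepsilon_G}{\sqrt t}\Bigr)}.$$
   Context: Setting. $\mathcal X\subseteq\mathbb R^d$ is a compact domain. Each agent $n\in\{1,\dots,N\}$ has an objective $f_n:\mathcal X\to\mathbb R$ with a maximizer $\mathbf{x}_n^*\in\arg\max_{\mathbf{x}\in\mathcal X}f_n(\mathbf{x})$. Agent $n$ starts with a nonempty initial dataset $\mathcal D_{n,0}$ of (location, observation) pairs. At round $t\ge1$ it queries $\mathbf{x}_{n,t}$, observes $y_{n,t}=f_n(\mathbf{x}_{n,t})+\epsilon_{n,t}$ (noise $\epsilon_{n,t}$), and sets $\mathcal D_{n,t}=\mathcal D_{n,t-1}\cup\{(\mathbf{x}_{n,t},y_{n,t})\}$. Local GP. For each agent a positive semidefinite kernel $k_n$ on $\mathcal X$ and a regularization parameter $\sigma_{\mathrm{gp}}^2>0$ are fixed. $\mu_{n,t-1}$ and $\sigma_{n,t-1}\ge0$ denote the Gaussian process (GP) regression posterior mean and standard deviation given $\mathcal D_{n,t-1}$, computed with kernel $k_n$ and Gaussian noise variance $\sigma_{\mathrm{gp}}^2$. Guidance. $G_{n,t}:\mathcal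 X\to\mathbb R$ is the guidance field available to agent $n$ when choosing its round-$t$ query; it satisfies $0\le G_{n,t}\le G_{\max}$ uniformly for a finite constant $G_{\max}$. (In the GUIDE-FBO algorithm, $G_{n,t}(\mathbf{x})=\sum_{p=1}^{P_t}\omega_{n,t,p}\exp\bigl(-\tfrac12(\mathbf{x}-\boldsymbol\mu_{n,t,p})^\top\boldsymbol\Sigma_{n,t,p}^{-1}(\mathbf{x}-\boldsymbol\mu_{n,t,p})\bigr)$ with $\omega_{n,t,p}\ge0$, $\sum_p\omega_{n,t,p}\le1$, $\boldsymbol\Sigma_{n,t,p}\succ0$, so $G_{\max}=1$ is a valid bound.) The maximizer defining the selection rule is assumed to exist. *)

theory Defs
  imports "HOL-Probability.Probability" "Jordan_Normal_Form.Gauss_Jordan_Elimination"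
    "Jordan_Normal_Form.Determinant"
begin

definition psd_kernel_on :: "'a set \<Rightarrow> ('a \<Rightarrow> 'a \<Rightarrow> real) \<Rightarrow> bool" where
  "psd_kernel_on X k \<longleftrightarrow>
     (\<forall>x\<in>X. \<forall>y\<in>X. k x y = k y x) \<and>
     (\<forall>m (z :: nat \<Rightarrow> 'a) (c :: nat \<Rightarrow> real). (\<forall>i<m. z i \<in> X) \<longrightarrow>
        0 \<le> (\<Sum>i<m. \<Sum>j<m. c i * c j * k (z i) (z j)))"

text \<open>
  A dataset is a list of (location, observation) pairs, so that a repeated pair counts
  as a further observation. The posterior below does not depend on the order of the list.
\<close>

definition gram_mat :: "('a \<Rightarrow> 'a \<Rightarrow> real) \<Rightarrow> ('a \<times> real) list \<Rightarrow> real mat" where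
  "gram_mat k ds = Matrix.mat (length ds) (length ds) (\<lambda>(i, j). k (fst (ds ! i)) (fst (ds ! j)))"

definition cross_vec :: "('a \<Rightarrow> 'a \<Rightarrow> real) \<Rightarrow> ('a \<times> real) list \<Rightarrow> 'a \<Rightarrow> real Matrix.vec" where
  "cross_vec k ds x = Matrix.vec (length ds) (\<lambda>i. k (fst (ds ! i)) x)"

definition obs_vec :: "('a \<times> real) list \<Rightarrow> real Matrix.vec" where
  "obs_vec ds = Matrix.vec (length ds) (\<lambda>i. snd (ds ! i))"

text \<open>
  The inverse of \<open>K + s2 I\<close>. It exists when the kernel is positive semidefinite
  and \<open>s2 > 0\<close>: see \<open>gp_precision_inverse\<close> below.
\<close>

definition gp_precision :: "('a \<Rightarrow> 'a \<Rightarrow> real) \<Rightarrow> real \<Rightarrow> ('a \<times> real) list \<Rightarrow> real mat" where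
  "gp_precision k s2 ds = the (mat_inverse (gram_mat k ds + s2 \<cdot>\<^sub>m 1\<^sub>m (length ds)))"

definition gp_mean :: "('a \<Rightarrow> 'a \<Rightarrow> real) \<Rightarrow> real \<Rightarrow> ('a \<times> real) list \<Rightarrow> 'a \<Rightarrow> real" where
  "gp_mean k s2 ds x = scalar_prod (cross_vec k ds x) (gp_precision k s2 ds *\<^sub>v obs_vec ds)"

definition gp_var :: "('a \<Rightarrow> 'a \<Rightarrow> real) \<Rightarrow> real \<Rightarrow> ('a \<times> real) list \<Rightarrow> 'a \<Rightarrow> real" where
  "gp_var k s2 ds x =
     k x x - scalar_prod (cross_vec k ds x) (gp_precision k s2 ds *\<^sub>v cross_vec k ds x)"

definition gp_sd :: "('a \<Rightarrow> 'a \<Rightarrow> real) \<Rightarrow> real \<Rightarrow> ('a \<times> real) list \<Rightarrow> 'a \<Rightarrow> real" where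
  "gp_sd k s2 ds x = sqrt (gp_var k s2 ds x)"

lemma gram_quadratic_form:
  assumes "v \<in> carrier_vec (length ds)"
  shows "scalar_prod v (gram_mat k ds *\<^sub>v v) =
    (\<Sum>i<length ds. \<Sum>j<length ds. vec_index v i * vec_index v j * k (fst (ds ! i)) (fst (ds ! j)))"
  using assms
  by (auto simp: gram_mat_def scalar_prod_def mult_mat_vec_def atLeast0LessThan
      sum_distrib_left mult_ac intro!: sum.cong)

lemma regularized_gram_mult_vec:
  assumes "v \<in> carrier_vec (length ds)"
  shows "(gram_mat k ds + s2 \<cdot>\<^sub>m 1\<^sub>m (length ds)) *\<^sub>v v = gram_mat k ds *\<^sub>v v + s2 \<cdot>\<^sub>v v"
proof -
  have "gram_mat k ds \<in> carrier_mat (length ds) (length ds)"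
    by (simp add: gram_mat_def)
  moreover have "(s2 \<cdot>\<^sub>m 1\<^sub>m (length ds)) *\<^sub>v v = s2 \<cdot>\<^sub>v v"
    using assms by (auto simp: mult_mat_vec_def intro!: eq_vecI)
  ultimately show ?thesis
    using assms by (simp add: add_mult_distrib_mat_vec)
qed

lemma gp_precision_inverse:
  assumes psd: "psd_kernel_on X k" and s2: "s2 > 0" and ds: "fst ` set ds \<subseteq> X"
  defines "n \<equiv> length ds"
  shows "gp_precision k s2 ds \<in> carrier_mat n n"
    and "(gram_mat k ds + s2 \<cdot>\<^sub>m 1\<^sub>m n) * gp_precision k s2 ds = 1\<^sub>m n"
    and "gp_precision k s2 ds * (gram_mat k ds + s2 \<cdot>\<^sub>m 1\<^sub>m n) = 1\<^sub>m n"
proof -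
  define A where "A = gram_mat k ds + s2 \<cdot>\<^sub>m 1\<^sub>m n"
  have K: "gram_mat k ds \<in> carrier_mat n n"
    by (simp add: gram_mat_def n_def)
  have A: "A \<in> carrier_mat n n"
    by (simp add: A_def)
  have "Determinant.det A \<noteq> 0"
  proof
    assume "Determinant.det A = 0"
    then obtain v where v: "v \<in> carrier_vec n" "v \<noteq> 0\<^sub>v n" "A *\<^sub>v v = 0\<^sub>v n"
      using det_0_iff_vec_prod_zero_field[OF A] by blast
    have "0 = scalar_prod v (A *\<^sub>v v)"
      using v by simp
    also have "\<dots> = scalar_prod v (gram_mat k ds *\<^sub>v v) + s2 * scalar_prod v v"
      using v(1) K regularized_gram_mult_vec[of v ds k s2]
      by (simp add: A_def n_def scalar_prod_add_distrib[where n = "length ds"])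
    finally have "scalar_prod v (gram_mat k ds *\<^sub>v v) + s2 * scalar_prod v v = 0" by simp
    moreover have "scalar_prod v (gram_mat k ds *\<^sub>v v) \<ge> 0"
      using psd ds v(1) unfolding psd_kernel_on_def n_def
      by (subst gram_quadratic_form) (auto simp: image_subset_iff)
    moreover have "scalar_prod v v > 0"
    proof -
      obtain i where i: "i < n" "vec_index v i \<noteq> 0"
        using v by (metis carrier_vecD eq_vecI index_zero_vec)
      have "0 < (\<Sum>j\<in>{0..<n}. vec_index v j * vec_index v j)"
        using i by (intro sum_pos2[of _ i]) (auto simp: zero_less_mult_iff)
      then show ?thesis
        using v by (simp add: scalar_prod_def)
    qed
    ultimately show False
      using mult_pos_pos[OF s2] by (smt (verit))
  qed
  then have "A \<in> Units (ring_mat TYPE(real) n ())"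
    by (rule det_non_zero_imp_unit[OF A])
  then obtain B where B: "mat_inverse A = Some B"
    using mat_inverse(1)[OF A, where b = "()"] by (cases "mat_inverse A") auto
  then have "gp_precision k s2 ds = B"
    by (simp add: gp_precision_def A_def n_def)
  with mat_inverse(2)[OF A B]
  show "gp_precision k s2 ds \<in> carrier_mat n n"
    "(gram_mat k ds + s2 \<cdot>\<^sub>m 1\<^sub>m n) * gp_precision k s2 ds = 1\<^sub>m n"
    "gp_precision k s2 ds * (gram_mat k ds + s2 \<cdot>\<^sub>m 1\<^sub>m n) = 1\<^sub>m n"
    by (simp_all add: A_def)
qed

lemma gp_var_nonneg:
  assumes psd: "psd_kernel_on X k" and s2: "s2 > 0" and ds: "fst ` set ds \<subseteq> X" and x: "x \<in> X"
  shows "0 \<le> gp_var k s2 ds x"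
proof -
  define n where "n = length ds"
  define b where "b = cross_vec k ds x"
  define w where "w = gp_precision k s2 ds *\<^sub>v b"
  define z where "z = (\<lambda>i. if i < n then fst (ds ! i) else x)"
  define c where "c = (\<lambda>i. if i < n then vec_index w i else -1)"
  note P = gp_precision_inverse[OF psd s2 ds, folded n_def]
  have K: "gram_mat k ds \<in> carrier_mat n n"
    by (simp add: gram_mat_def n_def)
  have b: "b \<in> carrier_vec n"
    by (simp add: b_def cross_vec_def n_def)
  have w: "w \<in> carrier_vec n"
    using P(1) b by (simp add: w_def)
  have "(gram_mat k ds + s2 \<cdot>\<^sub>m 1\<^sub>m n) *\<^sub>v w
      = ((gram_mat k ds + s2 \<cdot>\<^sub>m 1\<^sub>m n) * gp_precision k s2 ds) *\<^sub>v b"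
    unfolding w_def using P(1) b K by (intro assoc_mult_mat_vec[symmetric]) auto
  then have Aw: "gram_mat k ds *\<^sub>v w + s2 \<cdot>\<^sub>v w = b"
    using P(2) b w regularized_gram_mult_vec[of w ds k s2] by (simp add: n_def)
  have "scalar_prod w b = scalar_prod w (gram_mat k ds *\<^sub>v w) + s2 * scalar_prod w w"
    using w K by (simp add: Aw[symmetric] scalar_prod_add_distrib[where n = n])
  moreover have "0 \<le> s2 * scalar_prod w w"
    using s2 by (simp add: scalar_prod_def sum_nonneg)
  ultimately have q: "scalar_prod w (gram_mat k ds *\<^sub>v w) \<le> scalar_prod w b"
    by simp
  have in_X: "fst (ds ! i) \<in> X" if "i < n" for i
    using ds that by (auto simp: n_def image_subset_iff)
  have cross: "(\<Sum>i<n. vec_index w i * k (fst (ds ! i)) x) = scalar_prod w b"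
    by (simp add: b_def cross_vec_def scalar_prod_def n_def atLeast0LessThan)
  have cross': "(\<Sum>i<n. vec_index w i * k x (fst (ds ! i))) = scalar_prod w b"
  proof -
    have "(\<Sum>i<n. vec_index w i * k x (fst (ds ! i))) = (\<Sum>i<n. vec_index w i * k (fst (ds ! i)) x)"
      using psd in_X x by (intro sum.cong) (auto simp: psd_kernel_on_def)
    then show ?thesis
      using cross by simp
  qed
  have "0 \<le> (\<Sum>i<Suc n. \<Sum>j<Suc n. c i * c j * k (z i) (z j))"
  proof -
    have "\<forall>i<Suc n. z i \<in> X"
      using in_X x by (simp add: z_def)
    then show ?thesis
      using psd unfolding psd_kernel_on_def by blast
  qed
  also have "\<dots> = (\<Sum>i<n. \<Sum>j<n. vec_index w i * vec_index w j * k (fst (ds ! i)) (fst (ds ! j)))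
      - (\<Sum>i<n. vec_index w i * k (fst (ds ! i)) x) - (\<Sum>i<n. vec_index w i * k x (fst (ds ! i))) + k x x"
    by (simp add: c_def z_def sum.distrib sum_negf sum_subtractf)
  also have "\<dots> = scalar_prod w (gram_mat k ds *\<^sub>v w) - scalar_prod w b - scalar_prod w b + k x x"
    unfolding cross cross' using gram_quadratic_form[of w ds k] w by (simp add: n_def)
  also have "\<dots> \<le> k x x - scalar_prod w b"
    using q by simp
  also have "\<dots> = gp_var k s2 ds x"
    using comm_scalar_prod[OF w b] by (simp add: gp_var_def w_def b_def)
  finally show ?thesis .
qed

end

theory Submission
  imports Defs
begin

text \<open>Write b for the square root of \<beta> at round t, l for the guidance weight, and g*,
  s*, f* and g, s, f for guidance, posterior deviation and objective at the maximizer and at the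
  query. The 2 is one width b s from the acquisition value plus one from replacing m by f. Solving
  for s gives the claim. Putting c \<le> g* on the left and e \<ge> g on the right keeps the
  inequality, so \<open>ucb_sd_lower_bound\<close> covers both bounds. The argument is pathwise;
  probability enters only through the measure of \<open>E\<close>.\<close>

text \<open>
  Optimality of the query compares its acquisition value with that of the maximizer, and the
  confidence bounds turn both posterior means into values of the objective.
\<close>

lemma ucb_sd_lower_bound:
  fixes b l gs gx c e ms mx ss sx fs fx :: real
  assumes b: "b > 0" and l: "l \<ge> 0"
    and conf_star: "\<bar>fs - ms\<bar> \<le> b * ss" and conf_query: "\<bar>fx - mx\<bar> \<le> b * sx"
    and opt: "ms + b * (1 + l * gs) * ss \<le> mx + b * (1 + l * gx) * sx"
    and c: "c \<le> gs" and e: "gx \<le> e" "0 \<le> e"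
  shows "((fs - fx) + l * c * b * ss) / (b * (2 + l * e)) \<le> sx"
proof -
  \<comment> \<open>A confidence width dominates an absolute value, which fixes its sign; weakening
    the guidance values below relies on this.\<close>
  have s: "0 \<le> b * ss" "0 \<le> b * sx"
    using conf_star conf_query by linarith+
  have "l * c * (b * ss) \<le> l * gs * (b * ss)" "l * gx * (b * sx) \<le> l * e * (b * sx)"
    using l c e s by (auto intro!: mult_right_mono mult_left_mono)
  then have "(fs - fx) + l * c * b * ss \<le> sx * (b * (2 + l * e))"
    using conf_star conf_query opt by (auto simp: algebra_simps abs_le_iff)
  moreover have "0 < b * (2 + l * e)"
    using b l e by (simp add: add_pos_nonneg)
  ultimately show ?thesis
    by (simp add: pos_divide_le_eq)
qed

text \<open>Measurability of the queries, data and guidance in \<omega> is not assumed, so the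
  probability claim is phrased through a measurable set \<open>A\<close> inside the set where
  \<open>bounds\<close> holds.\<close>

theorem proposition1:
  fixes M :: "'w measure"
    and X :: "(real ^ 'd) set"
    and N :: nat
    and f :: "nat \<Rightarrow> real ^ 'd \<Rightarrow> real"
    and xstar :: "nat \<Rightarrow> real ^ 'd"
    and k :: "nat \<Rightarrow> real ^ 'd \<Rightarrow> real ^ 'd \<Rightarrow> real"
    and noise_var :: real
    and x :: "nat \<Rightarrow> nat \<Rightarrow> 'w \<Rightarrow> real ^ 'd"
    and y noise :: "nat \<Rightarrow> nat \<Rightarrow> 'w \<Rightarrow> real"
    and D :: "nat \<Rightarrow> nat \<Rightarrow> 'w \<Rightarrow> ((real ^ 'd) \<times> real) list"
    and \<mu> \<sigma> :: "nat \<Rightarrow> nat \<Rightarrow> 'w \<Rightarrow> real ^ 'd \<Rightarrow> real"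
    and G :: "nat \<Rightarrow> nat \<Rightarrow> 'w \<Rightarrow> real ^ 'd \<Rightarrow> real"
    and Gmax \<delta> :: real
    and \<beta> lam :: "nat \<Rightarrow> real"
    and E :: "'w set"
    and n t :: nat
  assumes prob_space: "prob_space M"
    and domain: "compact X"
    and maximizers: "\<forall>m\<in>{1..N}. is_arg_max (f m) (\<lambda>z. z \<in> X) (xstar m)"
    and kernels: "\<forall>m\<in>{1..N}. psd_kernel_on X (k m)"
    and noise_var: "noise_var > 0"
    and initial_data: "\<forall>m\<in>{1..N}. \<forall>\<omega>\<in>space M. D m 0 \<omega> \<noteq> [] \<and> fst ` set (D m 0 \<omega>) \<subseteq> X"
    and queries: "\<forall>m\<in>{1..N}. \<forall>s\<ge>1. \<forall>\<omega>\<in>space M. x m s \<omega> \<in> X"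
    and observations: "\<forall>m\<in>{1..N}. \<forall>s\<ge>1. \<forall>\<omega>\<in>space M. y m s \<omega> = f m (x m s \<omega>) + noise m s \<omega>"
    and data: "\<forall>m\<in>{1..N}. \<forall>s\<ge>1. \<forall>\<omega>\<in>space M. D m s \<omega> = D m (s - 1) \<omega> @ [(x m s \<omega>, y m s \<omega>)]"
    and post_mean: "\<And>m s \<omega> z. \<mu> m s \<omega> z = gp_mean (k m) noise_var (D m s \<omega>) z"
    and post_sd: "\<And>m s \<omega> z. \<sigma> m s \<omega> z = gp_sd (k m) noise_var (D m s \<omega>) z"
    and guidance: "\<forall>m\<in>{1..N}. \<forall>s\<ge>1. \<forall>\<omega>\<in>space M. \<forall>z\<in>X. 0 \<le> G m s \<omega> z \<and> G m s \<omega> z \<le> Gmax"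
    and delta: "0 < \<delta>" "\<delta> < 1"
    and beta_pos: "\<forall>s\<ge>1. \<beta> s > 0"
    and beta_mono: "mono_on {1..} \<beta>"
    and event: "E = {\<omega> \<in> space M. \<forall>m\<in>{1..N}. \<forall>s\<ge>1. \<forall>z\<in>X.
          \<bar>f m z - \<mu> m (s - 1) \<omega> z\<bar> \<le> sqrt (\<beta> s) * \<sigma> m (s - 1) \<omega> z}"
    and event_prob: "E \<in> sets M" "measure M E \<ge> 1 - \<delta>"
    and agent: "n \<in> {1..N}"
    and round: "t \<ge> 1"
    and lam_nonneg: "lam t \<ge> 0"
    and guide_ucb: "\<forall>\<omega>\<in>space M. is_arg_max
          (\<lambda>z. \<mu> n (t - 1) \<omega> z + sqrt (\<beta> t) * (1 + lam t * G n t \<omega> z) * \<sigma> n (t - 1) \<omega> z)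
          (\<lambda>z. z \<in> X) (x n t \<omega>)"
  defines "\<Delta> \<equiv> \<lambda>z. f n (xstar n) - f n z"
  defines "bounds \<equiv> \<lambda>\<omega>. \<Delta> (x n t \<omega>) > 0 \<longrightarrow>
        \<sigma> n (t - 1) \<omega> (x n t \<omega>) \<ge>
          (\<Delta> (x n t \<omega>) + lam t * sqrt (\<beta> t) * G n t \<omega> (xstar n) * \<sigma> n (t - 1) \<omega> (xstar n))
            / (sqrt (\<beta> t) * (2 + lam t * G n t \<omega> (x n t \<omega>))) \<and>
        (\<forall>c \<epsilon>G lam_max. c > 0 \<and> \<epsilon>G \<ge> 0 \<and> lam_max \<ge> 0 \<and>
            G n t \<omega> (xstar n) \<ge> c \<and> G n t \<omega> (x n t \<omega>) \<le> \<epsilon>G \<and> lam t = lam_max / sqrt (real t) \<longrightarrow>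
          \<sigma> n (t - 1) \<omega> (x n t \<omega>) \<ge>
            (\<Delta> (x n t \<omega>) + lam_max * c / sqrt (real t) * sqrt (\<beta> t) * \<sigma> n (t - 1) \<omega> (xstar n))
              / (sqrt (\<beta> t) * (2 + lam_max * \<epsilon>G / sqrt (real t))))"
  shows "(\<forall>\<omega>\<in>E. bounds \<omega>) \<and>
    (\<exists>A\<in>sets M. A \<subseteq> {\<omega> \<in> space M. bounds \<omega>} \<and> measure M A \<ge> 1 - \<delta>)"
proof -
  have bounds: "bounds \<omega>" if "\<omega> \<in> E" for \<omega>
  proof -
    let ?s = "xstar n" and ?q = "x n t \<omega>"
    have \<omega>: "\<omega> \<in> space M"
      using that by (simp add: event)
    have X: "?s \<in> X" "?q \<in> X"
      using maximizers queries agent round \<omega> by (auto simp: is_arg_max_def)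
    have b: "sqrt (\<beta> t) > 0"
      using beta_pos round by simp
    have conf: "\<bar>f n z - \<mu> n (t - 1) \<omega> z\<bar> \<le> sqrt (\<beta> t) * \<sigma> n (t - 1) \<omega> z" if "z \<in> X" for z
      using \<open>\<omega> \<in> E\<close> that agent round unfolding event by blast
    have opt: "\<mu> n (t - 1) \<omega> ?s + sqrt (\<beta> t) * (1 + lam t * G n t \<omega> ?s) * \<sigma> n (t - 1) \<omega> ?s
        \<le> \<mu> n (t - 1) \<omega> ?q + sqrt (\<beta> t) * (1 + lam t * G n t \<omega> ?q) * \<sigma> n (t - 1) \<omega> ?q"
      using guide_ucb \<omega> X(1) by (simp add: is_arg_max_linorder)
    note bound = ucb_sd_lower_bound[OF b lam_nonneg conf[OF X(1)] conf[OF X(2)] opt]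
    have "0 \<le> G n t \<omega> ?q"
      using guidance agent round \<omega> X(2) by blast
    \<comment> \<open>The first bound is the sharp choice: c and e are the actual guidance values at
      the maximizer and at the query.\<close>
    note first = bound[OF order_refl order_refl this]
    show ?thesis
      unfolding bounds_def \<Delta>_def
    proof (intro impI conjI allI)
      show "(f n ?s - f n ?q + lam t * sqrt (\<beta> t) * G n t \<omega> ?s * \<sigma> n (t - 1) \<omega> ?s)
          / (sqrt (\<beta> t) * (2 + lam t * G n t \<omega> ?q)) \<le> \<sigma> n (t - 1) \<omega> ?q"
        using first by (simp add: mult_ac)
    \<comment> \<open>The second bound keeps c and \<epsilon>G general and substitutes the schedule
      for \<open>lam t\<close>.\<close>
    qed (use bound in auto)
  qed
  moreover have "E \<subseteq> {\<omega> \<in> space M. bounds \<omega>}"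
    using bounds by (auto simp: event)
  \<comment> \<open>\<open>E\<close> itself serves as the witness \<open>A\<close>.\<close>
  ultimately show ?thesis
    using event_prob by blast
qed

end
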